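(* Let $n,k,r \in \mathbb{N}$ and $\varepsilon > 0$ satisfy $r \geqslant 3$ and $n \geqslant \frac{11(2+\varepsilon)}{\varepsilon}k^2r^2$. Then $$m(n,r,1,k) \;\geqslant\; \frac{n}{r-1} - \left(1 + \frac{1}{r(r-2)} + \varepsilon\right)k^2r.$$ In particular, if $r\geqslant 3$ and $n \geqslant 44k^2r^2$, then $m(n,r,1,k) \geqslant \frac{n}{r-1} - 2k^2r$.
   Context: A graph on at least $k+1$ vertices is $k$-connected if deleting any set of at most $k-1$ of its vertices leaves a connected graph. An $r$-colouring of $E(K_n)$ is a function $f:E(K_n)\to[r]$; a subgraph $H\subseteq K_n$ is monochromatic if $f$ is constant on $E(H)$. For $n\geqslant 2$ and $r,k\in\mathbb{N}$, $m(n,r,1,k)$ denotes the minimum, over all $r$-colourings $f$ of $E(K_n)$, of the maximum number of vertices of a monochromatic $k$-connected subgraph of $K_n$ (this maximum is $0$ if no such subgraph exists). *)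

theory Defs
  imports Complex_Main "HOL-Library.FuncSet"
begin

text \<open>A graph is a pair of a vertex set and a set of edges, the edges being two-element sets of
  vertices.\<close>

type_synonym 'a graph = "'a set \<times> 'a set set"

abbreviation verts :: "'a graph \<Rightarrow> 'a set" where
  "verts G \<equiv> fst G"

abbreviation edges :: "'a graph \<Rightarrow> 'a set set" where
  "edges G \<equiv> snd G"

definition simple_graph :: "'a graph \<Rightarrow> bool" where
  "simple_graph G \<longleftrightarrow> (\<forall>e\<in>edges G. e \<subseteq> verts G \<and> card e = 2)"

definition subgraph :: "'a graph \<Rightarrow> 'a graph \<Rightarrow> bool" where
  "subgraph H G \<longleftrightarrow> simple_graph H \<and> verts H \<subseteq> verts G \<and> edges H \<subseteq> edges G"

definition complete_graph :: "nat \<Rightarrow> nat graph" where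
  "complete_graph n = ({1..n}, {e. e \<subseteq> {1..n} \<and> card e = 2})"

definition delete_verts :: "'a graph \<Rightarrow> 'a set \<Rightarrow> 'a graph" where
  "delete_verts G S = (verts G - S, {e \<in> edges G. e \<inter> S = {}})"

definition connected_graph :: "'a graph \<Rightarrow> bool" where
  "connected_graph G \<longleftrightarrow> verts G \<noteq> {} \<and>
     (\<forall>u\<in>verts G. \<forall>v\<in>verts G. (u, v) \<in> {(x, y). {x, y} \<in> edges G}\<^sup>*)"

text \<open>Sets of at most \<open>k - 1\<close> vertices are written as \<open>card S < k\<close>, because subtraction on
  \<^typ>\<open>nat\<close> truncates at \<open>k = 0\<close>.\<close>

definition k_connected :: "nat \<Rightarrow> 'a graph \<Rightarrow> bool" where
  "k_connected k G \<longleftrightarrow> finite (verts G) \<and> k + 1 \<le> card (verts G) \<and>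
     (\<forall>S. S \<subseteq> verts G \<and> card S < k \<longrightarrow> connected_graph (delete_verts G S))"

definition colourings :: "nat \<Rightarrow> nat \<Rightarrow> (nat set \<Rightarrow> nat) set" where
  "colourings n r = edges (complete_graph n) \<rightarrow>\<^sub>E {1..r}"

definition monochromatic :: "('a set \<Rightarrow> 'c) \<Rightarrow> 'a graph \<Rightarrow> bool" where
  "monochromatic f H \<longleftrightarrow> (\<exists>c. \<forall>e\<in>edges H. f e = c)"

definition mono_connected_sizes :: "nat \<Rightarrow> nat \<Rightarrow> (nat set \<Rightarrow> nat) \<Rightarrow> nat set" where
  "mono_connected_sizes n k f =
     {card (verts H) | H. subgraph H (complete_graph n) \<and> monochromatic f H \<and> k_connected k H}"

text \<open>This is \<open>m(n, r, 1, k)\<close>. Inserting \<open>0\<close> gives the maximum \<open>0\<close> when there is no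
  monochromatic \<open>k\<close>-connected subgraph, and changes nothing otherwise.\<close>

definition m1 :: "nat \<Rightarrow> nat \<Rightarrow> nat \<Rightarrow> nat" where
  "m1 n r k = Min ((\<lambda>f. Max (insert 0 (mono_connected_sizes n k f))) ` colourings n r)"

text \<open>\<^const>\<open>Min\<close> and \<^const>\<open>Max\<close> are meaningful here, being taken over finite nonempty sets.\<close>

lemma finite_mono_connected_sizes: "finite (mono_connected_sizes n k f)"
proof (rule finite_subset)
  show "mono_connected_sizes n k f \<subseteq> {..n}"
  proof
    fix x assume "x \<in> mono_connected_sizes n k f"
    then obtain H :: "nat graph" where "x = card (verts H)" "verts H \<subseteq> {1..n}"
      by (auto simp: mono_connected_sizes_def subgraph_def complete_graph_def)
    then show "x \<in> {..n}"
      using card_mono[of "{1..n}" "verts H"] by simp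
  qed
qed simp

lemma finite_colourings: "finite (colourings n r)"
  unfolding colourings_def complete_graph_def
  by (auto intro!: finite_PiE finite_subset[of _ "Pow {1..n}"])

lemma colourings_nonempty: "r \<ge> 1 \<Longrightarrow> colourings n r \<noteq> {}"
  by (simp add: colourings_def PiE_eq_empty_iff)

end

theory Submission
  imports Defs
begin

text \<open>
  The heart of the proof is a bound in the style of Mader: if every \<open>k\<close>-connected subgraph of a
  bipartite graph with parts of sizes \<open>a\<close> and \<open>b\<close> has at most \<open>s\<close> vertices, then the graph has at
  most \<open>s a b / (a + b) + 2 (k - 1) (a + b)\<close> edges. Give every vertex of one part the weight
  \<open>p = s (b / (a + b))\<^sup>2 + 2 (k - 1)\<close>, and every vertex of the other part the weight
  \<open>w = s (a / (a + b))\<^sup>2 + 2 (k - 1)\<close>. The number of edges is then at most the total weight minus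
  \<open>(k - 1) max p w\<close>: a vertex of degree at most \<open>2 (k - 1)\<close> may be removed, and when a graph is
  split along fewer than \<open>k\<close> vertices, the subtracted term pays for the vertices counted twice.

  Let \<open>h\<close> be the largest order of a monochromatic \<open>k\<close>-connected subgraph and put \<open>q = r - 1\<close>.
  Summing the bound over all \<open>r\<close> colours between two halves of the vertex set gives
  \<open>h \<ge> n / r - 9 (k - 1) \<ge> (9 / 16) n / q\<close>. Now let \<open>H\<close> be a largest such subgraph. By maximality
  a vertex outside \<open>H\<close> sends at most \<open>k - 1\<close> edges of the colour of \<open>H\<close> to \<open>H\<close>, so nearly all edges
  between \<open>H\<close> and its complement have the other \<open>q\<close> colours. Summing the bound over these colours
  gives \<open>(q h / n) (n / q - h) \<le> (k - 1) (1 + 2 Q)\<close> with \<open>Q = q\<^sup>2 / (q - 1) \<ge> 4\<close>, and therefore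
  \<open>n / q - h \<le> (16 / 9) (k - 1) (9 / 4) Q = 4 (k - 1) Q \<le> k\<^sup>2 Q\<close>.
\<close>

section \<open>Separations of graphs that are not k-connected\<close>

text \<open>Some \<open>S\<close> with fewer than \<open>k\<close> vertices disconnects the graph.
  If \<open>C\<close> consists of the vertices still reachable from \<open>u\<close>, every edge
  leaving \<open>C\<close> ends in \<open>S\<close>, so \<open>C \<union> S\<close> and the
  complement of \<open>C\<close> meet exactly in \<open>S\<close> and no edge crosses between
  them.\<close>

lemma separation:
  assumes fin: "finite (verts G)" and simple: "simple_graph G"
    and big: "k + 1 \<le> card (verts G)" and not: "\<not> k_connected k G"
  obtains P Q where "P \<union> Q = verts G" "card (P \<inter> Q) < k" "P - Q \<noteq> {}" "Q - P \<noteq> {}"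
    "\<And>e. e \<in> edges G \<Longrightarrow> e \<subseteq> P \<or> e \<subseteq> Q"
proof -
  obtain S where S: "S \<subseteq> verts G" "card S < k" "\<not> connected_graph (delete_verts G S)"
    using assms unfolding k_connected_def by auto
  \<comment> \<open>Some vertex survives the deletion, so the failure of connectedness is a missing
    path and not an empty graph.\<close>
  have "card S < card (verts G)" using S(2) big by simp
  then have "verts G - S \<noteq> {}"
    using S(1) by (metis Diff_eq_empty_iff less_irrefl subset_antisym)
  define r where "r = {(x, y). {x, y} \<in> edges (delete_verts G S)}"
  obtain u v where u: "u \<in> verts G - S" and v: "v \<in> verts G - S" and uv: "(u, v) \<notin> r\<^sup>*"
    using S(3) \<open>verts G - S \<noteq> {}\<close> unfolding connected_graph_def r_def
    by (auto simp: delete_verts_def)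
  define C where "C = {x \<in> verts G - S. (u, x) \<in> r\<^sup>*}"
  show thesis
  proof (rule that[of "C \<union> S" "verts G - C"])
    have "(C \<union> S) \<inter> (verts G - C) = S" using S(1) by (auto simp: C_def)
    then show "card ((C \<union> S) \<inter> (verts G - C)) < k" using S(2) by simp
    show "C \<union> S \<union> (verts G - C) = verts G" using S(1) by (auto simp: C_def)
    have "u \<in> C" using u by (simp add: C_def)
    then show "C \<union> S - (verts G - C) \<noteq> {}" by auto
    have "v \<notin> C" using uv by (simp add: C_def)
    then show "verts G - C - (C \<union> S) \<noteq> {}" using v by auto
    fix e assume e: "e \<in> edges G"
    then have "e \<subseteq> verts G" "card e = 2" using simple by (auto simp: simple_graph_def)
    then obtain x y where xy: "e = {x, y}" "x \<in> verts G" "y \<in> verts G"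
      by (auto simp: card_2_iff)
    have step: "b \<in> C \<union> S" if "a \<in> C" "{a, b} = e" "b \<in> verts G" for a b
    proof (cases "b \<in> S")
      case False
      have "a \<notin> S" using that(1) by (simp add: C_def)
      then have "(a, b) \<in> r" using that e False by (auto simp: r_def delete_verts_def)
      then show ?thesis using that False by (auto simp: C_def intro: rtrancl_into_rtrancl)
    qed simp
    show "e \<subseteq> C \<union> S \<or> e \<subseteq> verts G - C"
      using step[of x y] step[of y x] xy by (auto simp: insert_commute)
  qed
qed

section \<open>Edge bounds for bipartite graphs\<close>

text \<open>\<open>R\<close> stays fixed and is read from the first part to the second. Shrinking
  \<open>X\<close> and \<open>Y\<close> then gives induced subgraphs, and for disjoint parts the
  edges are counted by \<open>R \<inter> X \<times> Y\<close>.\<close>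

definition bip :: "('a \<times> 'a) set \<Rightarrow> 'a set \<Rightarrow> 'a set \<Rightarrow> 'a graph" where
  "bip R X Y = (X \<union> Y, {{x, y} | x y. x \<in> X \<and> y \<in> Y \<and> (x, y) \<in> R})"

lemma simple_graph_bip: "X \<inter> Y = {} \<Longrightarrow> simple_graph (bip R X Y)"
  by (auto simp: simple_graph_def bip_def card_insert_if)

text \<open>A vertex of \<open>P - Q\<close> has all its neighbours in \<open>P\<close>. There are
  at least \<open>2 * k - 1\<close> of them, more than \<open>P \<inter> Q\<close> can hold, so one
  lies in \<open>P - Q\<close> too, and its own neighbours supply the other part. This provides the
  size conditions for the induction below.\<close>

lemma separation_side_large:
  fixes k :: nat
  assumes fin: "finite X" "finite Y" and k: "k \<ge> 1"
    and degX: "\<And>x. x \<in> X \<Longrightarrow> 2 * k - 1 \<le> card {y \<in> Y. (x, y) \<in> R}"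
    and degY: "\<And>y. y \<in> Y \<Longrightarrow> 2 * k - 1 \<le> card {x \<in> X. (x, y) \<in> R}"
    and PQ: "P \<union> Q = X \<union> Y" "card (P \<inter> Q) < k" "P - Q \<noteq> {}"
    and sep: "\<And>x y. x \<in> X \<Longrightarrow> y \<in> Y \<Longrightarrow> (x, y) \<in> R \<Longrightarrow> {x, y} \<subseteq> P \<or> {x, y} \<subseteq> Q"
  shows "k - 1 \<le> card (X \<inter> P) \<and> k - 1 \<le> card (Y \<inter> P)"
proof -
  have finPQ: "finite (P \<inter> Q)" using PQ(1) fin by (metis finite_Int finite_Un)
  have nX: "{y \<in> Y. (x, y) \<in> R} \<subseteq> Y \<inter> P" if "x \<in> X" "x \<notin> Q" for x
    using sep that by auto
  have nY: "{x \<in> X. (x, y) \<in> R} \<subseteq> X \<inter> P" if "y \<in> Y" "y \<notin> Q" for y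
    using sep that by auto
  have cX: "2 * k - 1 \<le> card (Y \<inter> P)" if "x \<in> X" "x \<notin> Q" for x
    using degX[OF that(1)] card_mono[OF _ nX[OF that]] fin by force
  have cY: "2 * k - 1 \<le> card (X \<inter> P)" if "y \<in> Y" "y \<notin> Q" for y
    using degY[OF that(1)] card_mono[OF _ nY[OF that]] fin by force
  have out: "\<exists>z. z \<in> T \<and> z \<notin> Q" if "2 * k - 1 \<le> card T" "T \<subseteq> P" for T
  proof (rule ccontr)
    assume "\<not> ?thesis"
    then have "T \<subseteq> P \<inter> Q" using that by auto
    then have "card T \<le> card (P \<inter> Q)" using finPQ by (rule card_mono[rotated])
    then show False using that PQ(2) k by simp
  qed
  obtain z where z: "z \<in> P" "z \<notin> Q" using PQ(3) by auto
  then consider "z \<in> X" | "z \<in> Y" using PQ(1) by auto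
  then show ?thesis
  proof cases
    case 1
    have "2 * k - 1 \<le> card (Y \<inter> P)" using cX 1 z by blast
    moreover obtain y where "y \<in> Y" "y \<notin> Q"
      using out[of "Y \<inter> P"] calculation by auto
    moreover have "2 * k - 1 \<le> card (X \<inter> P)" using cY calculation by blast
    ultimately show ?thesis by linarith
  next
    case 2
    have "2 * k - 1 \<le> card (X \<inter> P)" using cY 2 z by blast
    moreover obtain y where "y \<in> X" "y \<notin> Q"
      using out[of "X \<inter> P"] calculation by auto
    moreover have "2 * k - 1 \<le> card (Y \<inter> P)" using cX calculation by blast
    ultimately show ?thesis by linarith
  qed
qed

text \<open>With \<open>t = x + y\<close>, the identity
  \<open>t (\<beta>\<^sup>2 x + \<alpha>\<^sup>2 y) - x y = (\<beta> x - \<alpha> y)\<^sup>2\<close> linearises \<open>x y\<close> with equality at the balanced sizes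
  \<open>x : y = \<alpha> : \<beta>\<close>; the slack \<open>s - t\<close> of a small piece covers the term \<open>K max p w\<close>.\<close>

lemma rectangle_bound:
  fixes s \<alpha> \<beta> x y K :: real
  assumes "0 \<le> \<alpha>" "0 \<le> \<beta>" "\<alpha> + \<beta> = 1" "0 \<le> K" "K + 1 \<le> x" "K + 1 \<le> y" "x + y \<le> s"
    and p: "p = s * \<beta>\<^sup>2 + 2 * K" and w: "w = s * \<alpha>\<^sup>2 + 2 * K"
  shows "x * y \<le> p * x + w * y - K * max p w"
proof -
  \<comment> \<open>The last factor is \<open>w\<close> for \<gamma> = \<alpha> and \<open>p\<close>
    for \<gamma> = \<beta>, so the two instances together give the maximum.\<close>
  have *: "x * y \<le> p * x + w * y - K * (s * \<gamma>\<^sup>2 + 2 * K)"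
    if "\<gamma> = \<alpha> \<or> \<gamma> = \<beta>" for \<gamma>
  proof -
    define t where "t = x + y"
    have b: "\<beta> = 1 - \<alpha>" using assms by simp
    have "t * (\<beta>\<^sup>2 * x + \<alpha>\<^sup>2 * y) - x * y = (\<beta> * x - \<alpha> * y)\<^sup>2"
      unfolding t_def b by (simp add: power2_eq_square algebra_simps)
    then have 1: "x * y \<le> t * (\<beta>\<^sup>2 * x + \<alpha>\<^sup>2 * y)"
      by (smt (verit) zero_le_power2)
    have "\<gamma>\<^sup>2 * (K + 1) \<le> \<beta>\<^sup>2 * x + \<alpha>\<^sup>2 * y"
    proof -
      have "0 \<le> \<alpha>\<^sup>2 * y" "0 \<le> \<beta>\<^sup>2 * x" using assms by auto
      moreover have "\<alpha>\<^sup>2 * (K + 1) \<le> \<alpha>\<^sup>2 * y" "\<beta>\<^sup>2 * (K + 1) \<le> \<beta>\<^sup>2 * x"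
        using assms by (auto intro!: mult_left_mono)
      ultimately show ?thesis using that by auto
    qed
    then have 2: "(s - t) * (\<gamma>\<^sup>2 * (K + 1)) \<le> (s - t) * (\<beta>\<^sup>2 * x + \<alpha>\<^sup>2 * y)"
      using assms by (intro mult_left_mono) (auto simp: t_def)
    have g: "0 \<le> \<gamma>\<^sup>2" "\<gamma>\<^sup>2 \<le> 1" using that assms by (auto simp: power_le_one)
    have t: "t \<ge> 2 * K + 2" "t \<le> s" using assms by (auto simp: t_def)
    have 3: "0 \<le> (s - t) * \<gamma>\<^sup>2" using g t by simp
    have "t * \<gamma>\<^sup>2 \<le> t * 1" using g t assms by (intro mult_left_mono) auto
    then have "0 \<le> 2 * t - 2 * K - t * \<gamma>\<^sup>2" using t by linarith
    then have 4: "0 \<le> K * (2 * t - 2 * K - t * \<gamma>\<^sup>2)"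
      using assms(4) by simp
    \<comment> \<open>In this decomposition the first summand is at least \<open>x * y\<close> and
      the remaining ones are nonnegative.\<close>
    have "p * x + w * y - K * (s * \<gamma>\<^sup>2 + 2 * K)
       = t * (\<beta>\<^sup>2 * x + \<alpha>\<^sup>2 * y) + ((s - t) * (\<beta>\<^sup>2 * x + \<alpha>\<^sup>2 * y) - (s - t) * (\<gamma>\<^sup>2 * (K + 1)))
         + (s - t) * \<gamma>\<^sup>2 + K * (2 * t - 2 * K - t * \<gamma>\<^sup>2)"
      unfolding p w t_def by (simp add: algebra_simps power2_eq_square)
    then show ?thesis using 1 2 3 4 by linarith
  qed
  show ?thesis using *[of \<alpha>] *[of \<beta>] p w by (auto simp: max_def)
qed

text \<open>The weights depend on \<open>s\<close>, \<alpha> and \<beta> but not on \<open>X\<close>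
  and \<open>Y\<close>, so the bound is linear in the part sizes and adds up over the two pieces of
  a separation. Lower bounds on the sizes are essential: for empty parts and \<open>k > 1\<close>
  the right-hand side is negative.\<close>

lemma bipartite_edge_bound:
  fixes s \<alpha> \<beta> p w :: real and k :: nat
  assumes fin: "finite A" "finite B" and disj: "A \<inter> B = {}" and k: "k \<ge> 1"
    and ab: "0 \<le> \<alpha>" "0 \<le> \<beta>" "\<alpha> + \<beta> = 1" and s: "0 \<le> s"
    and p: "p = s * \<beta>\<^sup>2 + 2 * (real k - 1)" and w: "w = s * \<alpha>\<^sup>2 + 2 * (real k - 1)"
    and small: "\<And>X Y. X \<subseteq> A \<Longrightarrow> Y \<subseteq> B \<Longrightarrow> k_connected k (bip R X Y) \<Longrightarrow> real (card X + card Y) \<le> s"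
  shows "X \<subseteq> A \<Longrightarrow> Y \<subseteq> B \<Longrightarrow> k - 1 \<le> card X \<Longrightarrow> k - 1 \<le> card Y \<Longrightarrow>
    real (card (R \<inter> X \<times> Y)) \<le> p * card X + w * card Y - (real k - 1) * max p w"
proof (induction "card X + card Y" arbitrary: X Y rule: less_induct)
  case less
  have finX: "finite X" and finY: "finite Y" and XY: "X \<inter> Y = {}"
    using less.prems fin disj by (auto intro: finite_subset)
  define K where "K = real k - 1"
  have K: "0 \<le> K" "real (k - 1) = K" using k by (auto simp: K_def)
  have pw: "2 * K \<le> p" "2 * K \<le> w" using s by (auto simp: p w K_def)
  have cX: "K \<le> card X" and cY: "K \<le> card Y" using less.prems k by (auto simp: K_def)
  \<comment> \<open>Parts of size exactly \<open>k - 1\<close> are the base cases; from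
    \<open>k\<close> on, a vertex can be removed without leaving the range of the induction.\<close>
  consider (X) "card X = k - 1" | (Y) "card Y = k - 1"
    | (lowX) x where "x \<in> X" "k \<le> card X" "card {y \<in> Y. (x, y) \<in> R} \<le> 2 * (k - 1)"
    | (lowY) y where "y \<in> Y" "k \<le> card Y" "card {x \<in> X. (x, y) \<in> R} \<le> 2 * (k - 1)"
    | (conn) "k \<le> card X" "k \<le> card Y" "k_connected k (bip R X Y)"
    | (cut) "k \<le> card X" "k \<le> card Y" "\<not> k_connected k (bip R X Y)"
      "\<And>x. x \<in> X \<Longrightarrow> 2 * k - 1 \<le> card {y \<in> Y. (x, y) \<in> R}"
      "\<And>y. y \<in> Y \<Longrightarrow> 2 * k - 1 \<le> card {x \<in> X. (x, y) \<in> R}"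
  proof -
    have ge: "k \<le> card X \<or> card X = k - 1" "k \<le> card Y \<or> card Y = k - 1"
      using less.prems by linarith+
    note low = that(3,4)
    show thesis
    proof (rule ccontr)
      assume no: "\<not> thesis"
      have kX: "k \<le> card X" and kY: "k \<le> card Y" using ge no that(1,2) by blast+
      have "2 * k - 1 \<le> card {y \<in> Y. (x, y) \<in> R}" if x: "x \<in> X" for x
        using no low(1)[OF x kX] by (cases "card {y \<in> Y. (x, y) \<in> R} \<le> 2 * (k - 1)") auto
      moreover have "2 * k - 1 \<le> card {x \<in> X. (x, y) \<in> R}" if y: "y \<in> Y" for y
        using no low(2)[OF y kY] by (cases "card {x \<in> X. (x, y) \<in> R} \<le> 2 * (k - 1)") auto
      moreover have "\<not> k_connected k (bip R X Y)" using no that(5)[OF kX kY] by blast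
      ultimately show False using no that(6)[OF kX kY] by blast
    qed
  qed
  then have "real (card (R \<inter> X \<times> Y)) \<le> p * card X + w * card Y - K * max p w"
  proof cases
    case X
    have le: "card (R \<inter> X \<times> Y) \<le> card X * card Y"
      using card_mono[of "X \<times> Y" "R \<inter> X \<times> Y"] finX finY by (simp add: card_cartesian_product)
    have "real (card (R \<inter> X \<times> Y)) \<le> K * card Y" 
      using le X K by (metis of_nat_le_iff of_nat_mult)
    \<comment> \<open>The two estimates serve the two values of the maximum: if it is
      \<open>p\<close>, then \<open>p * K\<close> cancels; if it is \<open>w\<close>, then
      \<open>w * K\<close> is taken off \<open>w * card Y\<close>.\<close>
    moreover have "K * card Y \<le> w * card Y" using pw K by (intro mult_right_mono) auto
    moreover have "K * card Y \<le> p * K + w * (card Y - K)"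
    proof -
      have "(2 * K) * K \<le> p * K" "(2 * K) * (card Y - K) \<le> w * (card Y - K)"
        using pw cY K by (auto intro!: mult_right_mono)
      moreover have "(2 * K) * K + (2 * K) * (card Y - K) = 2 * (K * card Y)"
        by (simp add: algebra_simps)
      moreover have "0 \<le> K * card Y" using K by simp
      ultimately show ?thesis by linarith
    qed
    ultimately show ?thesis using X K by (auto simp: max_def algebra_simps)
  next
    case Y
    have le: "card (R \<inter> X \<times> Y) \<le> card X * card Y"
      using card_mono[of "X \<times> Y" "R \<inter> X \<times> Y"] finX finY by (simp add: card_cartesian_product)
    have "real (card (R \<inter> X \<times> Y)) \<le> K * card X" 
      using le Y K by (metis of_nat_le_iff of_nat_mult mult.commute)
    moreover have "K * card X \<le> p * card X" using pw K by (intro mult_right_mono) auto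
    moreover have "K * card X \<le> w * K + p * (card X - K)"
    proof -
      have "(2 * K) * K \<le> w * K" "(2 * K) * (card X - K) \<le> p * (card X - K)"
        using pw cX K by (auto intro!: mult_right_mono)
      moreover have "(2 * K) * K + (2 * K) * (card X - K) = 2 * (K * card X)"
        by (simp add: algebra_simps)
      moreover have "0 \<le> K * card X" using K by simp
      ultimately show ?thesis by linarith
    qed
    ultimately show ?thesis using Y K by (auto simp: max_def algebra_simps)
  next
    case lowX
    have c: "card (X - {x}) + 1 = card X"
      using lowX finX by (metis One_nat_def Suc_eq_plus1 card_Suc_Diff1)
    have "real (card (R \<inter> (X - {x}) \<times> Y)) \<le> p * card (X - {x}) + w * card Y - (real k - 1) * max p w"
      using less.prems lowX c by (intro less.hyps) auto
    moreover have eq: "R \<inter> X \<times> Y = (R \<inter> (X - {x}) \<times> Y) \<union> Pair x ` {y \<in> Y. (x, y) \<in> R}"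
      using lowX by auto
    have "card (R \<inter> X \<times> Y) \<le> card (R \<inter> (X - {x}) \<times> Y) + card (Pair x ` {y \<in> Y. (x, y) \<in> R})"
      unfolding eq by (rule card_Un_le)
    then have "real (card (R \<inter> X \<times> Y)) \<le> card (R \<inter> (X - {x}) \<times> Y) + 2 * K"
      using lowX(3) K by (simp add: card_image inj_on_def)
    moreover have "real (card X) = card (X - {x}) + 1" using c by linarith
    ultimately show ?thesis using pw by (simp add: K_def algebra_simps)
  next
    case lowY
    have c: "card (Y - {y}) + 1 = card Y"
      using lowY finY by (metis One_nat_def Suc_eq_plus1 card_Suc_Diff1)
    have "real (card (R \<inter> X \<times> (Y - {y}))) \<le> p * card X + w * card (Y - {y}) - (real k - 1) * max p w"
      using less.prems lowY c by (intro less.hyps) auto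
    moreover have eq: "R \<inter> X \<times> Y = (R \<inter> X \<times> (Y - {y})) \<union> (\<lambda>x. (x, y)) ` {x \<in> X. (x, y) \<in> R}"
      using lowY by auto
    have "card (R \<inter> X \<times> Y) \<le> card (R \<inter> X \<times> (Y - {y})) + card ((\<lambda>x. (x, y)) ` {x \<in> X. (x, y) \<in> R})"
      unfolding eq by (rule card_Un_le)
    then have "real (card (R \<inter> X \<times> Y)) \<le> card (R \<inter> X \<times> (Y - {y})) + 2 * K"
      using lowY(3) K by (simp add: card_image inj_on_def)
    moreover have "real (card Y) = card (Y - {y}) + 1" using c by linarith
    ultimately show ?thesis using pw by (simp add: K_def algebra_simps)
  next
    case conn
    have le: "card (R \<inter> X \<times> Y) \<le> card X * card Y"
      using card_mono[of "X \<times> Y" "R \<inter> X \<times> Y"] finX finY by (simp add: card_cartesian_product)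
    have "real (card X) + real (card Y) \<le> s" using small[OF less.prems(1,2) conn(3)] by simp
    then have "real (card X) * real (card Y) \<le> p * card X + w * card Y - K * max p w"
      using ab K conn p w by (intro rectangle_bound[of \<alpha> \<beta>]) (auto simp: K_def)
    then show ?thesis using le by (metis of_nat_le_iff of_nat_mult order_trans)
  next
    case cut
    have vb: "verts (bip R X Y) = X \<union> Y" by (simp add: bip_def)
    have "card (X \<union> Y) = card X + card Y" using finX finY XY by (rule card_Un_disjoint)
    then have big: "k + 1 \<le> card (verts (bip R X Y))" using cut k vb by simp
    have "finite (verts (bip R X Y))" using finX finY vb by simp
    from separation[OF this simple_graph_bip[OF XY] big cut(3)]
    obtain P Q where PQ: "P \<union> Q = X \<union> Y" "card (P \<inter> Q) < k" "P - Q \<noteq> {}" "Q - P \<noteq> {}"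
      and sep0: "\<And>e. e \<in> edges (bip R X Y) \<Longrightarrow> e \<subseteq> P \<or> e \<subseteq> Q"
      unfolding vb by metis
    have sep: "{x, y} \<subseteq> P \<or> {x, y} \<subseteq> Q" if "x \<in> X" "y \<in> Y" "(x, y) \<in> R" for x y
      by (rule sep0) (use that in \<open>auto simp: bip_def\<close>)
    \<comment> \<open>The minimum degree in this case is what makes both pieces admissible for the
      induction hypothesis.\<close>
    have P: "k - 1 \<le> card (X \<inter> P) \<and> k - 1 \<le> card (Y \<inter> P)"
      by (rule separation_side_large[OF finX finY k cut(4,5) PQ(1-3) sep])
    have Q: "k - 1 \<le> card (X \<inter> Q) \<and> k - 1 \<le> card (Y \<inter> Q)"
      by (rule separation_side_large[OF finX finY k cut(4,5), of Q P])
        (use PQ sep in \<open>auto simp: Un_commute Int_commute\<close>)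
    have finPQ: "finite P" "finite Q" using PQ(1) finX finY by (metis finite_Un)+
    have split: "card Z = card (X \<inter> Z) + card (Y \<inter> Z)" if "Z \<subseteq> X \<union> Y" for Z
    proof -
      have "Z = (X \<inter> Z) \<union> (Y \<inter> Z)" using that by auto
      then show ?thesis using card_Un_disjoint[of "X \<inter> Z" "Y \<inter> Z"] finX finY XY by auto
    qed
    have tot: "card (X \<union> Y) = card X + card Y" by fact
    have lt: "card P < card X + card Y" "card Q < card X + card Y"
      unfolding tot[symmetric] using PQ finX finY by (intro psubset_card_mono; auto)+
    have PQs: "P \<subseteq> X \<union> Y" "Q \<subseteq> X \<union> Y" using PQ(1) by blast+
    have 1: "real (card (R \<inter> (X \<inter> P) \<times> (Y \<inter> P)))
        \<le> p * card (X \<inter> P) + w * card (Y \<inter> P) - (real k - 1) * max p w"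
      using less.prems P lt split[OF PQs(1)] by (intro less.hyps) auto
    have 2: "real (card (R \<inter> (X \<inter> Q) \<times> (Y \<inter> Q)))
        \<le> p * card (X \<inter> Q) + w * card (Y \<inter> Q) - (real k - 1) * max p w"
      using less.prems Q lt split[OF PQs(2)] by (intro less.hyps) auto
    have eq: "R \<inter> X \<times> Y = (R \<inter> (X \<inter> P) \<times> (Y \<inter> P)) \<union> (R \<inter> (X \<inter> Q) \<times> (Y \<inter> Q))"
      using sep by auto
    have 3: "card (R \<inter> X \<times> Y) \<le> card (R \<inter> (X \<inter> P) \<times> (Y \<inter> P)) + card (R \<inter> (X \<inter> Q) \<times> (Y \<inter> Q))"
      unfolding eq by (rule card_Un_le)
    have inter: "card (Z \<inter> P) + card (Z \<inter> Q) = card Z + card (Z \<inter> (P \<inter> Q))"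
      if "Z \<subseteq> X \<union> Y" for Z
    proof -
      have "Z \<inter> P \<union> Z \<inter> Q = Z" "(Z \<inter> P) \<inter> (Z \<inter> Q) = Z \<inter> (P \<inter> Q)" using PQ that by auto
      then show ?thesis using card_Un_Int[of "Z \<inter> P" "Z \<inter> Q"] finPQ by auto
    qed
    have XX: "real (card (X \<inter> P)) + card (X \<inter> Q) = card X + real (card (X \<inter> (P \<inter> Q)))"
      "real (card (Y \<inter> P)) + card (Y \<inter> Q) = card Y + real (card (Y \<inter> (P \<inter> Q)))"
      using inter[OF Un_upper1] inter[OF Un_upper2] by linarith+
    have 4: "p * card (X \<inter> P) + p * card (X \<inter> Q) = p * card X + p * card (X \<inter> (P \<inter> Q))"
      unfolding distrib_left[symmetric] XX ..
    have 5: "w * card (Y \<inter> P) + w * card (Y \<inter> Q) = w * card Y + w * card (Y \<inter> (P \<inter> Q))"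
      unfolding distrib_left[symmetric] XX ..
    \<comment> \<open>Adding the two inductive bounds subtracts \<open>K * max p w\<close> twice.
      One copy is kept, the other pays for the at most \<open>K\<close> shared vertices.\<close>
    have "p * card (X \<inter> (P \<inter> Q)) + w * card (Y \<inter> (P \<inter> Q))
        \<le> max p w * card (X \<inter> (P \<inter> Q)) + max p w * card (Y \<inter> (P \<inter> Q))"
      by (intro add_mono mult_right_mono) auto
    also have "\<dots> = max p w * card (P \<inter> Q)"
      using split[OF le_infI1[OF PQs(1)], of Q] by (simp add: distrib_left)
    also have "\<dots> \<le> max p w * K"
      using PQ(2) pw K by (intro mult_left_mono) (auto simp: K_def)
    finally show ?thesis using 1 2 3 4 5 unfolding K_def by (simp add: mult.commute)
  qed
  then show ?case by (simp add: K_def)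
qed

text \<open>Taking \<alpha> and \<beta> proportional to \<open>a\<close> and \<open>b\<close>
  minimises \<open>\<beta>\<^sup>2 * a + \<alpha>\<^sup>2 * b\<close> under \<alpha> + \<beta> = 1,
  with minimum \<open>a * b / (a + b)\<close>. The subtracted maximum is then dropped.\<close>

lemma bipartite_edge_bound_harmonic:
  fixes s :: real and k :: nat
  assumes fin: "finite A" "finite B" and disj: "A \<inter> B = {}" and k: "k \<ge> 1" and s: "0 \<le> s"
    and small: "\<And>X Y. X \<subseteq> A \<Longrightarrow> Y \<subseteq> B \<Longrightarrow> k_connected k (bip R X Y) \<Longrightarrow> real (card X + card Y) \<le> s"
    and a: "a = real (card A)" "k - 1 \<le> card A" "card A > 0"
    and b: "b = real (card B)" "k - 1 \<le> card B" "card B > 0"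
  shows "real (card (R \<inter> A \<times> B)) \<le> s * (a * b / (a + b)) + 2 * (real k - 1) * (a + b)"
proof -
  define \<alpha> \<beta> where "\<alpha> = a / (a + b)" and "\<beta> = b / (a + b)"
  have pos: "a > 0" "b > 0" "a + b > 0" using a b by auto
  have ab: "0 \<le> \<alpha>" "0 \<le> \<beta>" "\<alpha> + \<beta> = 1"
    using pos by (auto simp: \<alpha>_def \<beta>_def add_divide_distrib[symmetric])
  define p w where "p = s * \<beta>\<^sup>2 + 2 * (real k - 1)" and "w = s * \<alpha>\<^sup>2 + 2 * (real k - 1)"
  have "real (card (R \<inter> A \<times> B)) \<le> p * card A + w * card B - (real k - 1) * max p w"
    using a b by (intro bipartite_edge_bound[OF fin disj k ab s p_def w_def small]) auto
  moreover have "0 \<le> p" using k s by (simp add: p_def)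
  then have "0 \<le> (real k - 1) * max p w" using k by simp
  moreover have "p * a + w * b = s * (\<beta>\<^sup>2 * a + \<alpha>\<^sup>2 * b) + 2 * (real k - 1) * (a + b)"
    by (simp add: p_def w_def algebra_simps)
  moreover have "\<beta>\<^sup>2 * a + \<alpha>\<^sup>2 * b = a * b / (a + b)"
  proof -
    have "\<beta>\<^sup>2 * a + \<alpha>\<^sup>2 * b = (a * b) * (a + b) / (a + b)\<^sup>2"
      by (simp add: \<alpha>_def \<beta>_def power_divide add_divide_distrib[symmetric])
        (simp add: power2_eq_square algebra_simps)
    then show ?thesis using pos by (simp add: power2_eq_square)
  qed
  ultimately show ?thesis using a b by simp
qed

section \<open>Adding a vertex to a k-connected graph\<close>

text \<open>Deleting fewer than \<open>k\<close> vertices leaves the old part connected, and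
  \<open>v\<close>, if it survives, keeps a neighbour there because \<open>N\<close> has at least
  \<open>k\<close> elements.\<close>

lemma k_connected_insert:
  assumes kc: "k_connected k H" and v: "v \<notin> verts H" and simple: "simple_graph H"
    and N: "N \<subseteq> verts H" "k \<le> card N"
  shows "k_connected k (insert v (verts H), edges H \<union> (\<lambda>x. {x, v}) ` N)" (is "k_connected k ?G")
  unfolding k_connected_def
proof (intro conjI allI impI)
  have fin: "finite (verts H)" using kc by (simp add: k_connected_def)
  show "finite (verts ?G)" using fin by simp
  show "k + 1 \<le> card (verts ?G)" using kc fin v by (simp add: k_connected_def)
  fix S assume S: "S \<subseteq> verts ?G \<and> card S < k"
  have finS: "finite S" using S fin by (auto intro: finite_subset)
  have sub: "e \<subseteq> verts H" if "e \<in> edges H" for e using simple that by (auto simp: simple_graph_def)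
  have "card (S - {v}) < k"
    using S finS card_mono[of S "S - {v}"] by auto
  moreover have "S - {v} \<subseteq> verts H" using S by auto
  ultimately have conn: "connected_graph (delete_verts H (S - {v}))"
    using kc unfolding k_connected_def by blast
  let ?r = "{(x, y). {x, y} \<in> edges (delete_verts H (S - {v}))}"
  let ?r' = "{(x, y). {x, y} \<in> edges (delete_verts ?G S)}"
  have "edges (delete_verts H (S - {v})) \<subseteq> edges (delete_verts ?G S)"
  proof
    fix e assume "e \<in> edges (delete_verts H (S - {v}))"
    then have e: "e \<in> edges H" "e \<inter> (S - {v}) = {}" by (auto simp: delete_verts_def)
    then have "v \<notin> e" using sub v by blast
    then have "e \<inter> S = {}" using e(2) by blast
    then show "e \<in> edges (delete_verts ?G S)" using e(1) by (simp add: delete_verts_def)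
  qed
  then have mono: "?r\<^sup>* \<subseteq> ?r'\<^sup>*" by (intro rtrancl_mono) auto
  have old: "(x, y) \<in> ?r'\<^sup>*" if "x \<in> verts H - S" "y \<in> verts H - S" for x y
  proof -
    have "(x, y) \<in> ?r\<^sup>*" using conn that unfolding connected_graph_def
      by (auto simp: delete_verts_def)
    then show ?thesis using mono by blast
  qed
  have ne: "verts H - S \<noteq> {}"
    using conn v by (auto simp: connected_graph_def delete_verts_def)
  show "connected_graph (delete_verts ?G S)"
  proof (cases "v \<in> S")
    case True
    then show ?thesis using old ne unfolding connected_graph_def
      by (auto simp: delete_verts_def)
  next
    case False
    have "\<not> N \<subseteq> S" using S N finS card_mono[of S N] by auto
    then obtain z where z: "z \<in> N" "z \<notin> S" by auto
    have zv: "(z, v) \<in> ?r'" "(v, z) \<in> ?r'"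
      using z False by (auto simp: delete_verts_def insert_commute)
    have zH: "z \<in> verts H - S" using z N by auto
    have to: "(x, z) \<in> ?r'\<^sup>* \<and> (z, x) \<in> ?r'\<^sup>*" if "x \<in> insert v (verts H) - S" for x
      using old[of x z] old[of z x] zH zv that by auto
    show ?thesis unfolding connected_graph_def
    proof (intro conjI ballI)
      show "verts (delete_verts ?G S) \<noteq> {}" using ne by (auto simp: delete_verts_def)
      fix x y assume "x \<in> verts (delete_verts ?G S)" "y \<in> verts (delete_verts ?G S)"
      then have "(x, z) \<in> ?r'\<^sup>*" "(z, y) \<in> ?r'\<^sup>*" using to by (auto simp: delete_verts_def)
      then show "(x, y) \<in> ?r'\<^sup>*" by (rule rtrancl_trans)
    qed
  qed
qed

section \<open>Colour classes between two vertex sets\<close>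

text \<open>A k-connected bipartite subgraph of one colour class is monochromatic, so the maximum
  over all such subgraphs can serve as \<open>s\<close>.\<close>

lemma colour_class_edge_bound:
  fixes k :: nat
  assumes k: "k \<ge> 1" and AB: "A \<union> B \<subseteq> {1..n}" "A \<inter> B = {}"
    and a: "a = real (card A)" "k - 1 \<le> card A" "card A > 0"
    and b: "b = real (card B)" "k - 1 \<le> card B" "card B > 0"
  shows "real (card ({(x, y). f {x, y} = c} \<inter> A \<times> B))
    \<le> Max (insert 0 (mono_connected_sizes n k f)) * (a * b / (a + b)) + 2 * (real k - 1) * (a + b)"
proof (rule bipartite_edge_bound_harmonic[OF _ _ AB(2) k _ _ a b])
  show "finite A" "finite B" using AB by (auto intro: finite_subset)
  show "0 \<le> real (Max (insert 0 (mono_connected_sizes n k f)))" by (rule of_nat_0_le_iff)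
  fix X Y assume XY: "X \<subseteq> A" "Y \<subseteq> B" and kc: "k_connected k (bip {(x, y). f {x, y} = c} X Y)"
  let ?G = "bip {(x, y). f {x, y} = c} X Y"
  have disj: "X \<inter> Y = {}" using XY AB by auto
  have simple: "simple_graph ?G" and sub: "verts ?G \<subseteq> {1..n}"
    using simple_graph_bip[OF disj] XY AB by (simp, auto simp: bip_def)
  have "edges ?G \<subseteq> edges (complete_graph n)"
    using simple sub unfolding simple_graph_def complete_graph_def snd_conv by blast
  then have "subgraph ?G (complete_graph n)"
    using simple sub by (simp add: subgraph_def complete_graph_def)
  moreover have "monochromatic f ?G" by (auto simp: monochromatic_def bip_def)
  ultimately have "card (verts ?G) \<in> mono_connected_sizes n k f"
    using kc unfolding mono_connected_sizes_def by blast
  then have "card (verts ?G) \<le> Max (insert 0 (mono_connected_sizes n k f))"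
    by (intro Max_ge) (auto simp: finite_mono_connected_sizes)
  moreover have "card (verts ?G) = card X + card Y"
    using disj kc by (auto simp: bip_def k_connected_def intro: card_Un_disjoint)
  ultimately show "real (card X + card Y) \<le> Max (insert 0 (mono_connected_sizes n k f))"
    by (metis of_nat_le_iff)
qed

lemma sum_colour_classes:
  assumes f: "f \<in> colourings n r" and AB: "A \<union> B \<subseteq> {1..n}" "A \<inter> B = {}"
  shows "(\<Sum>c\<in>{1..r}. real (card ({(x, y). f {x, y} = c} \<inter> A \<times> B))) = real (card A) * real (card B)"
proof -
  have fin: "finite (A \<times> B)" using AB by (auto intro: finite_subset)
  have "(\<Sum>c\<in>{1..r}. card ({(x, y). f {x, y} = c} \<inter> A \<times> B))
      = card (\<Union>c\<in>{1..r}. {(x, y). f {x, y} = c} \<inter> A \<times> B)"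
    using fin by (intro card_UN_disjoint[symmetric]) auto
  also have "(\<Union>c\<in>{1..r}. {(x, y). f {x, y} = c} \<inter> A \<times> B) = A \<times> B"
  proof -
    have "f {x, y} \<in> {1..r}" if "x \<in> A" "y \<in> B" for x y
    proof -
      have "{x, y} \<in> edges (complete_graph n)"
        using that AB by (auto simp: complete_graph_def card_insert_if)
      then show ?thesis using f unfolding colourings_def by blast
    qed
    then show ?thesis by auto
  qed
  finally have "real (\<Sum>c\<in>{1..r}. card ({(x, y). f {x, y} = c} \<inter> A \<times> B)) = real (card A * card B)"
    by (simp only: card_cartesian_product)
  then show ?thesis by (simp only: of_nat_sum of_nat_mult)
qed

section \<open>A first lower bound from two halves\<close>

lemma four_pred_le_square: "4 * (real k - 1) \<le> (real k)\<^sup>2"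
proof -
  have "0 \<le> (real k - 2)\<^sup>2" by simp
  then show ?thesis by (simp add: power2_eq_square algebra_simps)
qed

lemma mono_connected_size_weak:
  fixes n k r :: nat
  assumes f: "f \<in> colourings n r" and k: "k \<ge> 1" and r: "r \<ge> 3"
    and n: "real n \<ge> 11 * (real k)\<^sup>2 * (real r)\<^sup>2"
  shows "9 / 16 * (real n / (real r - 1)) \<le> Max (insert 0 (mono_connected_sizes n k f))"
proof -
  define h where "h = Max (insert 0 (mono_connected_sizes n k f))"
  have k2: "real k \<le> (real k)\<^sup>2" "1 \<le> (real k)\<^sup>2"
    using k self_le_power[of "real k" 2] by auto
  have "3\<^sup>2 \<le> (real r)\<^sup>2" using r by (intro power_mono) auto
  then have "11 * (real k)\<^sup>2 * 9 \<le> 11 * (real k)\<^sup>2 * (real r)\<^sup>2" by (intro mult_left_mono) auto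
  then have n99: "99 * real k \<le> real n" using n k2 by linarith
  define A B where "A = {1..n div 2}" and "B = {n div 2 + 1..n}"
  define a b where "a = real (card A)" and "b = real (card B)"
  have cA: "card A = n div 2" and cB: "card B = n - n div 2" by (auto simp: A_def B_def)
  have sz: "k - 1 \<le> card A" "k - 1 \<le> card B" "card A > 0" "card B > 0"
    using n99 k unfolding cA cB by linarith+
  have abn: "a + b = real n" unfolding a_def b_def cA cB by simp
  have AB: "A \<union> B \<subseteq> {1..n}" "A \<inter> B = {}" by (auto simp: A_def B_def)
  have pos: "a \<ge> 1" "b \<ge> 1" using sz by (auto simp: a_def b_def)
  have "a * b = (\<Sum>c\<in>{1..r}. real (card ({(x, y). f {x, y} = c} \<inter> A \<times> B)))"
    unfolding a_def b_def by (rule sum_colour_classes[OF f AB, symmetric])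
  also have "\<dots> \<le> (\<Sum>c\<in>{1..r}. h * (a * b / (a + b)) + 2 * (real k - 1) * (a + b))"
    unfolding h_def using sz by (intro sum_mono colour_class_edge_bound[OF k AB a_def _ _ b_def])
  finally have 1: "a * b \<le> r * (h * (a * b / n) + 2 * (real k - 1) * n)"
    by (simp add: abn)
  have n0: "real n > 0" using pos abn by linarith
  \<comment> \<open>The halves differ by at most one. Sizes 1 and 2 give equality, whence the
    constant 9.\<close>
  have "2 * (a + b)\<^sup>2 \<le> 9 * (a * b)"
  proof -
    have "n - n div 2 = n div 2 \<or> n - n div 2 = n div 2 + 1" by linarith
    then have "b = a \<or> b = a + 1" unfolding a_def b_def cA cB by auto
    moreover have "a * 1 \<le> a * a" using pos by (intro mult_left_mono) auto
    then have "2 \<le> a + a * a" using pos by linarith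
    ultimately show ?thesis by (auto simp: power2_eq_square algebra_simps)
  qed
  then have "2 * n * n / (a * b) \<le> 9"
    using pos by (simp add: abn power2_eq_square field_simps)
  then have 2: "(real k - 1) * (2 * n * n / (a * b)) \<le> (real k - 1) * 9"
    using k by (intro mult_left_mono) auto
  have "a * b * (n / (a * b * r)) \<le> r * (h * (a * b / n) + 2 * (real k - 1) * n) * (n / (a * b * r))"
    using 1 pos r by (intro mult_right_mono) auto
  also have "\<dots> = h + (real k - 1) * (2 * n * n / (a * b))"
    using pos n0 r by (simp add: field_simps)
  also have "a * b * (n / (a * b * r)) = n / real r" using pos by simp
  finally have 3: "n / real r \<le> h + (real k - 1) * 9" using 2 by linarith
  have r1: "real r - 1 > 0" using r by simp
  \<comment> \<open>The fraction on the right increases with \<open>r\<close> and equals 5/32 at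
    \<open>r = 3\<close>.\<close>
  have "n / real r * (5 / 32) \<le> n / real r * ((7 * real r - 16) / (16 * (real r - 1)))"
    using r r1 by (intro mult_left_mono) (auto simp: field_simps)
  also have "\<dots> = n / real r - 9 / 16 * (real n / (real r - 1))"
    using r r1 by (simp add: field_simps)
  finally have 4: "n / real r * (5 / 32) \<le> n / real r - 9 / 16 * (real n / (real r - 1))" .
  have "11 * (real k)\<^sup>2 * 3 \<le> 11 * (real k)\<^sup>2 * real r"
    using r by (intro mult_left_mono) auto
  also have "\<dots> \<le> n / real r"
    using n r by (simp add: field_simps power2_eq_square)
  finally have "9 * (real k - 1) \<le> n / real r * (5 / 32)"
    using four_pred_le_square[of k] k by simp
  then show ?thesis using 3 4 unfolding h_def[symmetric] by linarith
qed

section \<open>The complement of a largest monochromatic subgraph\<close>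

text \<open>Otherwise \<open>k_connected_insert\<close> would add \<open>y\<close> to
  \<open>H\<close> within colour \<open>c\<close>, against the maximality of
  \<open>H\<close>.\<close>

lemma few_colour_edges_to_extremal:
  assumes H: "subgraph H (complete_graph n)" "k_connected k H" "\<And>e. e \<in> edges H \<Longrightarrow> f e = c"
    and max: "card (verts H) = Max (insert 0 (mono_connected_sizes n k f))"
    and y: "y \<in> {1..n} - verts H"
  shows "card {x \<in> verts H. f {x, y} = c} < k"
proof (rule ccontr)
  define N where "N = {x \<in> verts H. f {x, y} = c}"
  assume "\<not> ?thesis"
  then have N: "N \<subseteq> verts H" "k \<le> card N" by (auto simp: N_def)
  have simple: "simple_graph H" and HV: "verts H \<subseteq> {1..n}" and HE: "edges H \<subseteq> edges (complete_graph n)"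
    using H by (auto simp: subgraph_def complete_graph_def)
  have fin: "finite (verts H)" using HV by (rule finite_subset) simp
  define G where "G = (insert y (verts H), edges H \<union> (\<lambda>x. {x, y}) ` N)"
  have kc: "k_connected k G"
    unfolding G_def using H(2) y simple N by (intro k_connected_insert) auto
  have new: "card {x, y} = 2" if "x \<in> N" for x using that N y by (auto simp: card_insert_if)
  have "simple_graph G"
    using simple N(1) new by (auto simp: simple_graph_def G_def)
  moreover have "verts G \<subseteq> {1..n}" using HV y by (auto simp: G_def)
  moreover have "edges G \<subseteq> edges (complete_graph n)"
    using HE HV y N(1) new by (auto simp: complete_graph_def G_def)
  ultimately have "subgraph G (complete_graph n)" by (simp add: subgraph_def complete_graph_def)
  moreover have "monochromatic f G"
    using H(3) by (auto simp: monochromatic_def G_def N_def)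
  ultimately have "card (verts G) \<in> mono_connected_sizes n k f"
    using kc unfolding mono_connected_sizes_def by blast
  then have "card (verts G) \<le> card (verts H)"
    unfolding max by (intro Max_ge) (auto simp: finite_mono_connected_sizes)
  moreover have "card (verts G) = card (verts H) + 1" using y fin by (simp add: G_def)
  ultimately show False by simp
qed

lemma mono_connected_size_bound:
  fixes n k r :: nat
  assumes f: "f \<in> colourings n r" and k: "k \<ge> 1" and r: "r \<ge> 3"
    and n: "real n \<ge> 11 * (real k)\<^sup>2 * (real r)\<^sup>2"
  shows "real n / (real r - 1) - (real k)\<^sup>2 * ((real r - 1)\<^sup>2 / (real r - 2))
    \<le> Max (insert 0 (mono_connected_sizes n k f))"
proof -
  define h where "h = Max (insert 0 (mono_connected_sizes n k f))"
  define q where "q = real r - 1"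
  define Q where "Q = q\<^sup>2 / (q - 1)"
  have q: "q \<ge> 2" using r by (simp add: q_def)
  have "q\<^sup>2 - 4 * (q - 1) = (q - 2)\<^sup>2" by (simp add: power2_eq_square algebra_simps)
  then have "4 * (q - 1) \<le> q\<^sup>2" by (smt (verit) zero_le_power2)
  then have Q: "4 \<le> Q" using q by (simp add: Q_def field_simps)
  have weak: "9 / 16 * (real n / q) \<le> h"
    unfolding h_def q_def using mono_connected_size_weak[OF f k r n] .
  have k2: "real k \<le> (real k)\<^sup>2" "1 \<le> (real k)\<^sup>2"
    using k self_le_power[of "real k" 2] by auto
  have "3\<^sup>2 \<le> (real r)\<^sup>2" using r by (intro power_mono) auto
  then have "11 * (real k)\<^sup>2 * 9 \<le> 11 * (real k)\<^sup>2 * (real r)\<^sup>2" by (intro mult_left_mono) auto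
  then have n99: "99 * real k \<le> real n" using n k2 by linarith
  have n0: "real n > 0" using n99 k by linarith
  \<comment> \<open>Positivity excludes the default value 0, so \<open>h\<close> is the order of an
    actual subgraph.\<close>
  have h0: "real h > 0" using weak n0 q by (smt (verit) divide_pos_pos mult_pos_pos)
  have "real n / q - (real k)\<^sup>2 * Q \<le> h"
  proof (cases "real h < real n / q")
    case False
    have "0 \<le> (real k)\<^sup>2 * Q" using Q by simp
    then show ?thesis using False by linarith
  next
    case True
    have "h \<in> insert 0 (mono_connected_sizes n k f)"
      unfolding h_def by (intro Max_in) (auto simp: finite_mono_connected_sizes)
    then have "h \<in> mono_connected_sizes n k f" using h0 by auto
    then obtain H where H: "subgraph H (complete_graph n)" "monochromatic f H" "k_connected k H"
      and Hh: "card (verts H) = h" unfolding mono_connected_sizes_def by auto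
    \<comment> \<open>\<open>monochromatic\<close> allows any constant, even outside \<open>{1..r}\<close> when there are no edges.\<close>
    have "\<exists>c\<in>{1..r}. \<forall>e\<in>edges H. f e = c"
    proof (cases "edges H = {}")
      case True
      then show ?thesis using r by (intro bexI[of _ 1]) auto
    next
      case False
      then obtain e where e: "e \<in> edges H" by auto
      then have "e \<in> edges (complete_graph n)" using H(1) by (auto simp: subgraph_def)
      then have "f e \<in> {1..r}" using f unfolding colourings_def by blast
      moreover have "\<forall>e'\<in>edges H. f e' = f e" using H(2) e by (auto simp: monochromatic_def)
      ultimately show ?thesis by blast
    qed
    then obtain c where c: "c \<in> {1..r}" "\<And>e. e \<in> edges H \<Longrightarrow> f e = c" by auto
    define A B where "A = verts H" and "B = {1..n} - verts H"
    define a b where "a = real (card A)" and "b = real (card B)"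
    have HV: "verts H \<subseteq> {1..n}" using H(1) by (auto simp: subgraph_def complete_graph_def)
    have fin: "finite A" "finite B" using HV by (auto simp: A_def B_def intro: finite_subset)
    have AB: "A \<union> B \<subseteq> {1..n}" "A \<inter> B = {}" using HV by (auto simp: A_def B_def)
    have cA: "card A = h" by (simp add: A_def Hh)
    have "card A + card B = n"
      using HV fin by (simp add: A_def B_def card_Diff_subset card_mono[of "{1..n}", simplified])
    then have abn: "a + b = real n" by (metis a_def b_def of_nat_add)
    have ah: "a = h" by (simp add: a_def cA)
    \<comment> \<open>In this case \<open>H\<close> covers at most half of the vertices, so
      \<open>B\<close> is large enough for the edge bound.\<close>
    have "real n / q \<le> real n / 2" using q by (intro divide_left_mono) auto
    then have bn2: "real n / 2 \<le> b" using True ah abn by linarith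
    have sz: "k - 1 \<le> card A" "card A > 0" "k - 1 \<le> card B" "card B > 0"
    proof -
      show "k - 1 \<le> card A" "card A > 0"
        using H(3) by (auto simp: k_connected_def A_def)
      have "real k \<le> real (card B)" using bn2 n99 k unfolding b_def by linarith
      then show "k - 1 \<le> card B" "card B > 0" using k by linarith+
    qed
    let ?E = "\<lambda>c. {(x, y). f {x, y} = c} \<inter> A \<times> B"
    have "card (?E c) \<le> (k - 1) * card B"
    proof -
      have eq: "?E c = (\<Union>y\<in>B. (\<lambda>x. (x, y)) ` {x \<in> A. f {x, y} = c})" by auto
      have "card (?E c) \<le> (\<Sum>y\<in>B. card ((\<lambda>x. (x, y)) ` {x \<in> A. f {x, y} = c}))"
        unfolding eq by (rule card_UN_le[OF fin(2)])
      also have "\<dots> \<le> (\<Sum>y\<in>B. k - 1)"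
      proof (rule sum_mono)
        fix y assume "y \<in> B"
        then have "card {x \<in> A. f {x, y} = c} < k"
          unfolding A_def B_def
          using few_colour_edges_to_extremal[OF H(1,3), of f c] c(2) Hh h_def by simp
        then show "card ((\<lambda>x. (x, y)) ` {x \<in> A. f {x, y} = c}) \<le> k - 1"
          by (simp add: card_image inj_on_def)
      qed
      finally show ?thesis by (simp add: mult.commute)
    qed
    then have "real (card (?E c)) \<le> real ((k - 1) * card B)" by (rule of_nat_mono)
    then have own: "real (card (?E c)) \<le> (real k - 1) * b"
      using k by (simp add: b_def of_nat_diff)
    \<comment> \<open>Colour \<open>c\<close> is split off and estimated by \<open>own\<close>. Only
      the other \<open>q\<close> colours are charged the bipartite bound, which puts
      \<open>q\<close> instead of \<open>r\<close> into the leading term.\<close>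
    have "a * b = (\<Sum>c\<in>{1..r}. real (card (?E c)))"
      unfolding a_def b_def by (rule sum_colour_classes[OF f AB, symmetric])
    also have "\<dots> = real (card (?E c)) + (\<Sum>d\<in>{1..r} - {c}. real (card (?E d)))"
      using c(1) by (intro sum.remove) auto
    also have "(\<Sum>d\<in>{1..r} - {c}. real (card (?E d)))
        \<le> (\<Sum>d\<in>{1..r} - {c}. h * (a * b / (a + b)) + 2 * (real k - 1) * (a + b))"
      unfolding h_def using sz by (intro sum_mono colour_class_edge_bound[OF k AB a_def _ _ b_def])
    also have "\<dots> = q * (h * (a * b / (a + b)) + 2 * (real k - 1) * (a + b))"
      using c(1) r by (simp add: q_def of_nat_diff)
    finally have main: "h * b \<le> (real k - 1) * b + q * (h * (h * b / n) + 2 * (real k - 1) * n)"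
      using own unfolding abn unfolding ah by linarith
    have b0: "b > 0" using bn2 n0 by linarith
    \<comment> \<open>This bound on \<open>b\<close> is the source of the denominator
      \<open>q - 1\<close> in \<open>Q\<close>.\<close>
    have "n - real n / q \<le> b" using True ah abn by linarith
    then have "n * (q - 1) / q \<le> b" using q by (simp add: field_simps)
    then have nb: "n / b \<le> q / (q - 1)" using q b0 by (simp add: field_simps)
    have "h * b / b \<le> ((real k - 1) * b + q * (h * (h * b / n) + 2 * (real k - 1) * n)) / b"
      using main b0 by (intro divide_right_mono) auto
    also have "\<dots> = (real k - 1) + q * h * h / n + (real k - 1) * (2 * q * (n / b))"
      using b0 n0 by (simp add: field_simps)
    also have "(real k - 1) * (2 * q * (n / b)) \<le> (real k - 1) * (2 * q * (q / (q - 1)))"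
      using nb k q by (intro mult_left_mono) auto
    also have "2 * q * (q / (q - 1)) = 2 * Q" by (simp add: Q_def power2_eq_square)
    finally have "h - q * h * h / n \<le> (real k - 1) * (1 + 2 * Q)"
      using b0 by (simp add: algebra_simps)
    also have "h - q * h * h / n = (q * h / n) * (n / q - h)"
      using q n0 by (simp add: field_simps)
    finally have 1: "(q * h / n) * (n / q - h) \<le> (real k - 1) * (1 + 2 * Q)" .
    \<comment> \<open>The first lower bound keeps the factor in front of the deficit
      \<open>n / q - h\<close> away from 0.\<close>
    have "9 / 16 \<le> q * h / n" using weak q n0 by (simp add: field_simps)
    then have "9 / 16 * (n / q - h) \<le> (q * h / n) * (n / q - h)"
      using True by (intro mult_right_mono) auto
    also note 1
    \<comment> \<open>Here \<open>4 \<le> Q\<close> absorbs the 1, and 9/4 = 9/16 * 4 lets the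
      factor 9/16 cancel.\<close>
    also have "(real k - 1) * (1 + 2 * Q) \<le> (real k - 1) * (9 / 4 * Q)"
      using Q k by (intro mult_left_mono) auto
    also have "\<dots> = 9 / 16 * (4 * (real k - 1) * Q)" by simp
    finally have "n / q - h \<le> 4 * (real k - 1) * Q" by (simp only: mult_le_cancel_left_pos)
    also have "\<dots> \<le> (real k)\<^sup>2 * Q"
      using four_pred_le_square[of k] Q by (intro mult_right_mono) auto
    finally show ?thesis by simp
  qed
  moreover have "Q = (real r - 1)\<^sup>2 / (real r - 2)" by (simp add: Q_def q_def)
  ultimately show ?thesis unfolding q_def h_def by simp
qed

section \<open>Passing to the minimum over colourings\<close>

text \<open>For \<open>k = 0\<close> no set \<open>S\<close> satisfies \<open>card S < k\<close>, so
  even the edgeless graph on all vertices qualifies, provided there is a vertex. This settles the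
  case outside the main argument, which works with \<open>k - 1\<close>.\<close>

lemma m1_zero: "r \<ge> 1 \<Longrightarrow> n \<le> m1 n r 0"
proof -
  assume r: "r \<ge> 1"
  have "n \<le> Max (insert 0 (mono_connected_sizes n 0 f))" for f :: "nat set \<Rightarrow> nat"
  proof (cases "n = 0")
    case False
    let ?H = "({1..n}, {}) :: nat graph"
    have "subgraph ?H (complete_graph n)" "monochromatic f ?H" "k_connected 0 ?H"
      using False
      by (auto simp: subgraph_def simple_graph_def complete_graph_def monochromatic_def k_connected_def)
    then have "card (verts ?H) \<in> mono_connected_sizes n 0 f"
      unfolding mono_connected_sizes_def by blast
    then show ?thesis by (intro Max_ge) (auto simp: finite_mono_connected_sizes)
  qed simp
  then show ?thesis
    unfolding m1_def using r finite_colourings colourings_nonempty by (subst Min_ge_iff) auto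
qed

lemma m1_bound:
  fixes n k r :: nat
  assumes r: "r \<ge> 3" and n: "real n \<ge> 11 * (real k)\<^sup>2 * (real r)\<^sup>2"
  shows "real n / (real r - 1) - (1 + 1 / (real r * (real r - 2))) * (real k)\<^sup>2 * real r \<le> m1 n r k"
proof (cases "k = 0")
  case True
  have "real n / (real r - 1) \<le> real n / 1" using r by (intro divide_left_mono) auto
  also have "\<dots> \<le> m1 n r k" using m1_zero[of r n] r True by simp
  finally show ?thesis using True by simp
next
  case False
  have "m1 n r k \<in> (\<lambda>f. Max (insert 0 (mono_connected_sizes n k f))) ` colourings n r"
    unfolding m1_def using r finite_colourings colourings_nonempty[of r n] by (intro Min_in) auto
  then obtain f where f: "f \<in> colourings n r" "m1 n r k = Max (insert 0 (mono_connected_sizes n k f))"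
    by auto
  \<comment> \<open>Both sides equal \<open>r + 1 / (r - 2)\<close>, as
    \<open>(r - 1)\<^sup>2 = r * (r - 2) + 1\<close>.\<close>
  have "(1 + 1 / (real r * (real r - 2))) * real r = (real r - 1)\<^sup>2 / (real r - 2)"
    using r by (simp add: field_simps power2_eq_square)
  then have "(1 + 1 / (real r * (real r - 2))) * (real k)\<^sup>2 * real r
      = (real k)\<^sup>2 * ((real r - 1)\<^sup>2 / (real r - 2))"
    by (metis mult.assoc mult.commute)
  then show ?thesis using mono_connected_size_bound[OF f(1) _ r n] False f(2) by simp
qed

theorem theorem3p7:
  fixes n k r :: nat
  assumes "r \<ge> 3"
  shows "(\<forall>\<epsilon>::real. \<epsilon> > 0 \<and> real n \<ge> 11 * (2 + \<epsilon>) / \<epsilon> * (real k)^2 * (real r)^2 \<longrightarrow>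
            real (m1 n r k) \<ge> real n / (real r - 1)
              - (1 + 1 / (real r * (real r - 2)) + \<epsilon>) * (real k)^2 * real r)
       \<and> (n \<ge> 44 * k^2 * r^2 \<longrightarrow>
            real (m1 n r k) \<ge> real n / (real r - 1) - 2 * (real k)^2 * real r)"
proof (intro conjI allI impI)
  fix \<epsilon> :: real
  assume *: "\<epsilon> > 0 \<and> real n \<ge> 11 * (2 + \<epsilon>) / \<epsilon> * (real k)^2 * (real r)^2"
  \<comment> \<open>The factor (2 + \<epsilon>) / \<epsilon> is at least 1, so the threshold of
    \<open>m1_bound\<close> is reached.\<close>
  have "11 * ((real k)\<^sup>2 * (real r)\<^sup>2) \<le> 11 * (2 + \<epsilon>) / \<epsilon> * ((real k)\<^sup>2 * (real r)\<^sup>2)"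
    using * by (intro mult_right_mono) (auto simp: field_simps)
  then have "real n \<ge> 11 * (real k)\<^sup>2 * (real r)\<^sup>2" using * by (simp add: mult.assoc)
  from m1_bound[OF assms this] have "real n / (real r - 1)
      - (1 + 1 / (real r * (real r - 2))) * (real k)\<^sup>2 * real r \<le> m1 n r k" .
  moreover have "0 \<le> \<epsilon> * (real k)\<^sup>2 * real r" using * by simp
  ultimately show "real (m1 n r k) \<ge> real n / (real r - 1)
      - (1 + 1 / (real r * (real r - 2)) + \<epsilon>) * (real k)^2 * real r"
    by (simp add: algebra_simps)
next
  \<comment> \<open>The constant 44 is 11 (2 + \<epsilon>) / \<epsilon> at \<epsilon> = 2/3, the
    value making the error coefficient 2 at \<open>r = 3\<close>; here \<open>m1_bound\<close> is
    applied directly.\<close>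
  assume "n \<ge> 44 * k^2 * r^2"
  then have "real n \<ge> real (44 * k^2 * r^2)" by (rule of_nat_mono)
  then have "real n \<ge> 44 * ((real k)\<^sup>2 * (real r)\<^sup>2)" by (simp add: mult.assoc)
  moreover have "0 \<le> (real k)\<^sup>2 * (real r)\<^sup>2" by simp
  ultimately have "real n \<ge> 11 * (real k)\<^sup>2 * (real r)\<^sup>2" by linarith
  note m1_bound[OF assms this]
  moreover have "1 * 1 \<le> real r * (real r - 2)" using assms by (intro mult_mono) auto
  then have "1 + 1 / (real r * (real r - 2)) \<le> 2" by simp
  then have "(1 + 1 / (real r * (real r - 2))) * ((real k)\<^sup>2 * real r) \<le> 2 * ((real k)\<^sup>2 * real r)"
    by (rule mult_right_mono) simp
  ultimately show "real (m1 n r k) \<ge> real n / (real r - 1) - 2 * (real k)^2 * real r"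
    by (simp add: mult.assoc)
qed

end
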